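(* Let $N$ be a normal subgroup of a finitely generated group $\Gamma$, and suppose that $N$ is finitely generated as a group. Let $\nu\colon\mathbb{R}_{>0}\times\mathbb{N}\to\mathbb{N}\cup\{0,\infty\}$ be monotone non-decreasing in the first argument. Then: (1) If $\Gamma$ is stable (resp. $\nu$-flexibly stable), then $\Gamma/N$ is stable (resp. $\nu$-flexibly stable). (2) If $\Gamma$ is BS-rigid (resp. $\nu$-flexibly BS-rigid), then $\Gamma/N$ is BS-rigid (resp. $\nu$-flexibly BS-rigid).
   Context: Write $[n]=\{1,\dots,n\}$ and $\mathrm{Sym}(n)$ for the symmetric group on $[n]$. For $\sigma\in\mathrm{Sym}(n)$ and $\tau\in\mathrm{Sym}(M)$ with $M\ge n$, $d(\sigma,\tau)=d(\tau,\sigma)=\frac1n|\{x\in[n]\mid\sigma x\neq\tau x\}|$. For a group $\Gamma$, $f\colon\Gamma\to\mathrm{Sym}(n)$ and finite $Q\subset\Gamma$, $N_{f,Q}$ is the distribution on $2^Q$ of $\{\gamma\in Q\mid f(\gamma)x=x\}$ with $x$ uniform in $[n]$; $d_{\mathrm{TV}}$ is total variation distance (half the $\ell^1$ distance). Call a sequence of functions $(f_\ell\colon\Gamma\to\mathrm{Sym}(n_\ell))_{\ell=1}^\infty$ with $n_\ell\to\infty$ an asymptotic homomorphism if $d(f_\ell(\gamma_1\gamma_2),f_\ell(\gamma_1)f_\ell(\gamma_2))\to0$ for all $\gamma_1,\gamma_2\in\Gamma$. Call it $\nu$-correctable if there are positive reals $\varepsilon_\ell\to0$ and homomorphisms $(h_\ell\colon\Gamma\to\mathrm{Sym}(N_\ell))_{\ell=1}^\infty$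 with $n_\ell\le N_\ell\le n_\ell+\nu(\varepsilon_\ell,n_\ell)$ such that $d(f_\ell(\gamma),h_\ell(\gamma))\to0$ for all $\gamma\in\Gamma$. A group $\Gamma$ is $\nu$-flexibly stable if every asymptotic homomorphism is $\nu$-correctable. It is $\nu$-flexibly BS-rigid if every asymptotic homomorphism $(f_\ell)$ for which there exist homomorphisms $(g_\ell\colon\Gamma\to\mathrm{Sym}(n_\ell))_{\ell=1}^\infty$ with $d_{\mathrm{TV}}(N_{f_\ell,Q},N_{g_\ell,Q})\to0$ for every finite $Q\subset\Gamma$ is $\nu$-correctable. Stable and BS-rigid mean the respective notions with $\nu=0$. *)

theory Defs
  imports
    "HOL-Algebra.Sym_Groups"
    "HOL-Probability.Probability_Mass_Function"
    "HOL-Library.Extended_Nat"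
begin

definition finitely_generated :: "('a, 'b) monoid_scheme \<Rightarrow> bool" where
  "finitely_generated G \<longleftrightarrow> (\<exists>S. finite S \<and> S \<subseteq> carrier G \<and> generate G S = carrier G)"

text \<open>
  An element of \<open>carrier (sym_group n)\<close> is a function on \<^typ>\<open>nat\<close> permuting \<open>{1..n}\<close> and fixing
  everything else, so it does not determine \<open>n\<close>. The distance therefore takes \<open>n\<close> explicitly;
  when the two permutations have different degrees, \<open>n\<close> is the smaller degree.
\<close>

definition perm_dist :: "nat \<Rightarrow> (nat \<Rightarrow> nat) \<Rightarrow> (nat \<Rightarrow> nat) \<Rightarrow> real" where
  "perm_dist n \<sigma> \<tau> = real (card {x \<in> {1..n}. \<sigma> x \<noteq> \<tau> x}) / real n"

definition stabilizer_pmf :: "nat \<Rightarrow> ('a \<Rightarrow> nat \<Rightarrow> nat) \<Rightarrow> 'a set \<Rightarrow> 'a set pmf" where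
  "stabilizer_pmf n f Q = map_pmf (\<lambda>x. {\<gamma> \<in> Q. f \<gamma> x = x}) (pmf_of_set {1..n})"

definition tv_dist :: "'c pmf \<Rightarrow> 'c pmf \<Rightarrow> real" where
  "tv_dist p q = (\<Sum>\<^sub>\<infinity>x. \<bar>pmf p x - pmf q x\<bar>) / 2"

text \<open>
  A sequence of functions \<open>f l\<close> from a group to the symmetric groups of degree \<open>n l\<close> is given by
  the pair of \<open>n\<close> and \<open>f\<close>. Sequences are indexed from 0.
\<close>

definition asymptotic_hom ::
  "('a, 'b) monoid_scheme \<Rightarrow> (nat \<Rightarrow> nat) \<Rightarrow> (nat \<Rightarrow> 'a \<Rightarrow> nat \<Rightarrow> nat) \<Rightarrow> bool" where
  "asymptotic_hom G n f \<longleftrightarrow>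
     (\<forall>l. 0 < n l) \<and>
     filterlim n at_top sequentially \<and>
     (\<forall>l. f l \<in> carrier G \<rightarrow> carrier (sym_group (n l))) \<and>
     (\<forall>\<gamma>1 \<in> carrier G. \<forall>\<gamma>2 \<in> carrier G.
        (\<lambda>l. perm_dist (n l) (f l (\<gamma>1 \<otimes>\<^bsub>G\<^esub> \<gamma>2)) (f l \<gamma>1 \<otimes>\<^bsub>sym_group (n l)\<^esub> f l \<gamma>2))
          \<longlonglongrightarrow> 0)"

definition correctable ::
  "(real \<Rightarrow> nat \<Rightarrow> enat) \<Rightarrow> ('a, 'b) monoid_scheme \<Rightarrow>
     (nat \<Rightarrow> nat) \<Rightarrow> (nat \<Rightarrow> 'a \<Rightarrow> nat \<Rightarrow> nat) \<Rightarrow> bool" where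
  "correctable \<nu> G n f \<longleftrightarrow>
     (\<exists>(\<epsilon> :: nat \<Rightarrow> real) (m :: nat \<Rightarrow> nat) (h :: nat \<Rightarrow> 'a \<Rightarrow> nat \<Rightarrow> nat).
        (\<forall>l. 0 < \<epsilon> l) \<and> \<epsilon> \<longlonglongrightarrow> 0 \<and>
        (\<forall>l. h l \<in> hom G (sym_group (m l))) \<and>
        (\<forall>l. n l \<le> m l \<and> enat (m l) \<le> enat (n l) + \<nu> (\<epsilon> l) (n l)) \<and>
        (\<forall>\<gamma> \<in> carrier G. (\<lambda>l. perm_dist (n l) (f l \<gamma>) (h l \<gamma>)) \<longlonglongrightarrow> 0))"

definition flexibly_stable ::
  "(real \<Rightarrow> nat \<Rightarrow> enat) \<Rightarrow> ('a, 'b) monoid_scheme \<Rightarrow> bool" where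
  "flexibly_stable \<nu> G \<longleftrightarrow> (\<forall>n f. asymptotic_hom G n f \<longrightarrow> correctable \<nu> G n f)"

definition flexibly_BS_rigid ::
  "(real \<Rightarrow> nat \<Rightarrow> enat) \<Rightarrow> ('a, 'b) monoid_scheme \<Rightarrow> bool" where
  "flexibly_BS_rigid \<nu> G \<longleftrightarrow>
     (\<forall>n f. asymptotic_hom G n f \<and>
        (\<exists>g. (\<forall>l. g l \<in> hom G (sym_group (n l))) \<and>
             (\<forall>Q. finite Q \<and> Q \<subseteq> carrier G \<longrightarrow>
                (\<lambda>l. tv_dist (stabilizer_pmf (n l) (f l) Q) (stabilizer_pmf (n l) (g l) Q))
                  \<longlonglongrightarrow> 0))
        \<longrightarrow> correctable \<nu> G n f)"

definition stable :: "('a, 'b) monoid_scheme \<Rightarrow> bool" where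
  "stable G \<longleftrightarrow> flexibly_stable (\<lambda>_ _. 0) G"

definition BS_rigid :: "('a, 'b) monoid_scheme \<Rightarrow> bool" where
  "BS_rigid G \<longleftrightarrow> flexibly_BS_rigid (\<lambda>_ _. 0) G"

end

theory Submission
  imports Defs
begin

text \<open>
  Pull an asymptotic homomorphism of \<open>\<Gamma>/N\<close> back to \<open>\<Gamma>\<close> and correct it there by homomorphisms
  \<open>h\<^sub>l\<close>. The generators of \<open>N\<close> are sent close to the identity, and there are only finitely many
  of them, so \<open>N\<close> fixes almost every point under \<open>h\<^sub>l\<close>. Since \<open>N\<close> is normal, its set of fixed
  points is invariant under \<open>\<Gamma>\<close>. Keep the action on this set and let \<open>\<Gamma>\<close> act trivially on the
  remaining few points: the resulting action has the same degree and factors through \<open>\<Gamma>/N\<close>.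
\<close>

section \<open>Permutation actions and the common fixed points of a normal subgroup\<close>

lemma hom_sym_group_one:
  assumes "group G" "h \<in> hom G (sym_group m)"
  shows "h \<one>\<^bsub>G\<^esub> = id"
  using group_hom.hom_one[of G "sym_group m" h] assms sym_group_is_group
  by (simp add: group_hom_def group_hom_axioms_def sym_group_one)

lemma hom_sym_group_mult:
  assumes "h \<in> hom G (sym_group m)" "a \<in> carrier G" "b \<in> carrier G"
  shows "h (a \<otimes>\<^bsub>G\<^esub> b) x = h a (h b x)"
  using hom_mult[OF assms] by (simp add: sym_group_mult)

text \<open>Reduces a condition on all of \<open>N\<close> to finitely many points of view: once a
  generating set fixes \<open>x\<close>, so does everything it generates.\<close>

lemma fixed_points_subgroup:
  fixes G (structure)
  assumes "group G" "h \<in> hom G (sym_group m)"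
  shows "subgroup {\<gamma> \<in> carrier G. h \<gamma> x = x} G"
proof -
  interpret group G by fact
  show ?thesis
  proof (rule subgroupI)
    show "{\<gamma> \<in> carrier G. h \<gamma> x = x} \<noteq> {}"
      using hom_sym_group_one[OF assms] by force
  next
    fix a assume a: "a \<in> {\<gamma> \<in> carrier G. h \<gamma> x = x}"
    then have "h (inv a) (h a x) = x"
      using hom_sym_group_mult[OF assms(2), of "inv a" a x] hom_sym_group_one[OF assms] by simp
    with a show "inv a \<in> {\<gamma> \<in> carrier G. h \<gamma> x = x}"
      by simp
  qed (auto simp: hom_sym_group_mult[OF assms(2)])
qed

text \<open>By normality \<open>a \<otimes> \<gamma>\<close> equals \<open>\<gamma>\<close> times a
  conjugate of \<open>a\<close> lying in \<open>N\<close>, so \<open>h \<gamma>\<close> preserves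
  the common fixed points of \<open>N\<close>. Restricting to this invariant set and acting
  trivially elsewhere is again an action.\<close>

lemma trivial_off_fixed_points_hom:
  fixes G (structure)
  assumes N: "N \<lhd> G" and h: "h \<in> hom G (sym_group m)"
  shows "(\<lambda>\<gamma> x. if \<forall>a\<in>N. h a x = x then h \<gamma> x else x) \<in> hom G (sym_group m)"
    (is "?k \<in> _")
proof -
  interpret normal N G by fact
  note one = hom_sym_group_one[OF is_group h] and mult = hom_sym_group_mult[OF h]
  have fixed: "h a (h \<gamma> x) = h \<gamma> x"
    if "\<forall>a\<in>N. h a x = x" "\<gamma> \<in> carrier G" "a \<in> N" for a \<gamma> x
  proof -
    have "inv \<gamma> \<otimes> a \<otimes> \<gamma> \<in> N"
      using that inv_op_closed1 by blast
    moreover have "a \<otimes> \<gamma> = \<gamma> \<otimes> (inv \<gamma> \<otimes> a \<otimes> \<gamma>)"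
      using that by (simp add: m_assoc[symmetric])
    ultimately show ?thesis
      using that mult[of a \<gamma> x] mult[of \<gamma> "inv \<gamma> \<otimes> a \<otimes> \<gamma>" x] by simp
  qed
  \<comment> \<open>The case distinction has the same outcome at \<open>x\<close> and at
    \<open>?k b x\<close>: by \<open>fixed\<close> if \<open>N\<close> fixes \<open>x\<close>, and
    because \<open>?k b x = x\<close> otherwise.\<close>
  have k_mult: "?k (a \<otimes> b) = ?k a \<circ> ?k b" if "a \<in> carrier G" "b \<in> carrier G" for a b
    using that fixed by (auto simp: mult fun_eq_iff)
  have k_one: "?k \<one> = id"
    using one by auto
  have "?k \<gamma> permutes {1..m}" if "\<gamma> \<in> carrier G" for \<gamma>
  proof -
    have "?k (inv \<gamma>) \<circ> ?k \<gamma> = id" "?k \<gamma> \<circ> ?k (inv \<gamma>) = id"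
      using that k_one by (simp_all only: k_mult[symmetric] inv_closed l_inv r_inv)
    then have "bij (?k \<gamma>)"
      by (rule o_bij)
    moreover have "?k \<gamma> x = x" if "x \<notin> {1..m}" for x
      using that hom_in_carrier[OF h \<open>\<gamma> \<in> carrier G\<close>] by (auto simp: sym_group_carrier permutes_def)
    ultimately show ?thesis
      unfolding permutes_def by (auto simp: bij_iff)
  qed
  then show ?thesis
    using k_mult by (intro homI) (simp_all add: sym_group_carrier sym_group_mult)
qed

text \<open>The modified action is trivial on \<open>N\<close>, hence constant on cosets. The degree
  \<open>m\<close> is unchanged, so a bound on it survives the descent.\<close>

lemma trivial_off_fixed_points_factor:
  fixes G (structure)
  assumes N: "N \<lhd> G" and h: "h \<in> hom G (sym_group m)"
  obtains k where "k \<in> hom (G Mod N) (sym_group m)"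
    and "\<And>\<gamma> x. \<gamma> \<in> carrier G \<Longrightarrow> k (N #> \<gamma>) x = (if \<forall>a\<in>N. h a x = x then h \<gamma> x else x)"
proof -
  interpret normal N G by fact
  let ?k = "\<lambda>\<gamma> x. if \<forall>a\<in>N. h a x = x then h \<gamma> x else x"
  note k_hom = trivial_off_fixed_points_hom[OF assms]
  have "?k a = ?k b" if ab: "a \<in> carrier G" "b \<in> carrier G" "N #> a = N #> b" for a b
  proof -
    have "b \<in> N #> a"
      using ab rcos_self[OF ab(2) is_subgroup] by simp
    then obtain c where c: "c \<in> N" "b = c \<otimes> a"
      unfolding r_coset_def by blast
    \<comment> \<open>Either \<open>N\<close> fixes \<open>y\<close>, and then so does
      \<open>c\<close>, or the second branch returns \<open>y\<close>.\<close>
    have "?k c y = y" for y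
      using c by simp
    then have "?k b x = ?k a x" for x
      unfolding c(2) using hom_sym_group_mult[OF k_hom, of c a x] c(1) ab(1) by simp
    then show ?thesis by (simp add: fun_eq_iff)
  qed
  then obtain k where "k \<in> hom (G Mod N) (sym_group m)"
    "\<And>\<gamma>. \<gamma> \<in> carrier G \<Longrightarrow> k (N #> \<gamma>) = ?k \<gamma>"
    using FactGroup_universal[OF k_hom N] by blast
  then show thesis
    by (intro that[of k]) simp_all
qed

section \<open>Distance estimates and correction over the quotient\<close>

text \<open>A union bound: where \<open>\<tau>'\<close> and \<open>\<tau>\<close> differ, some
  \<open>\<alpha> s\<close> moves the point, and there \<open>\<rho>\<close> cannot agree with both
  \<open>\<alpha> s\<close> and \<open>id\<close>. The map \<open>\<rho>\<close> serves as an
  intermediate point for comparing \<open>\<alpha> s\<close> with \<open>id\<close>.\<close>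

lemma perm_dist_le_trivial_off_fixed_points:
  assumes "finite S"
    and "\<And>x. (\<And>s. s \<in> S \<Longrightarrow> \<alpha> s x = x) \<Longrightarrow> \<tau>' x = \<tau> x"
  shows "perm_dist n \<sigma> \<tau>' \<le> perm_dist n \<sigma> \<tau> + (\<Sum>s\<in>S. perm_dist n \<rho> (\<alpha> s) + perm_dist n \<rho> id)"
proof -
  define D where "D \<sigma> \<tau> = {x \<in> {1..n}. \<sigma> x \<noteq> \<tau> x}" for \<sigma> \<tau> :: "nat \<Rightarrow> nat"
  have fin: "finite (D \<sigma> \<tau>)" for \<sigma> \<tau>
    by (simp add: D_def)
  have "D \<sigma> \<tau>' \<subseteq> D \<sigma> \<tau> \<union> (\<Union>s\<in>S. D \<rho> (\<alpha> s) \<union> D \<rho> id)"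
  proof
    fix x assume x: "x \<in> D \<sigma> \<tau>'"
    show "x \<in> D \<sigma> \<tau> \<union> (\<Union>s\<in>S. D \<rho> (\<alpha> s) \<union> D \<rho> id)"
    proof (cases "\<forall>s\<in>S. \<alpha> s x = x")
      case True
      then show ?thesis using x assms(2)[of x] by (simp add: D_def)
    next
      case False
      then obtain s where "s \<in> S" "\<alpha> s x \<noteq> x" by blast
      moreover from this have "x \<in> D \<rho> (\<alpha> s) \<union> D \<rho> id"
        using x by (auto simp: D_def)
      ultimately show ?thesis by blast
    qed
  qed
  then have "card (D \<sigma> \<tau>') \<le> card (D \<sigma> \<tau> \<union> (\<Union>s\<in>S. D \<rho> (\<alpha> s) \<union> D \<rho> id))"
    using fin assms(1) by (intro card_mono) auto
  also have "\<dots> \<le> card (D \<sigma> \<tau>) + card (\<Union>s\<in>S. D \<rho> (\<alpha> s) \<union> D \<rho> id)"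
    by (rule card_Un_le)
  also have "\<dots> \<le> card (D \<sigma> \<tau>) + (\<Sum>s\<in>S. card (D \<rho> (\<alpha> s)) + card (D \<rho> id))"
    using card_UN_le[OF assms(1), of "\<lambda>s. D \<rho> (\<alpha> s) \<union> D \<rho> id"]
    by (meson add_left_mono card_Un_le order_trans sum_mono)
  finally have "real (card (D \<sigma> \<tau>'))
      \<le> real (card (D \<sigma> \<tau>)) + (\<Sum>s\<in>S. real (card (D \<rho> (\<alpha> s))) + real (card (D \<rho> id)))"
    by (simp flip: of_nat_add of_nat_sum)
  then have "real (card (D \<sigma> \<tau>')) / n
      \<le> (real (card (D \<sigma> \<tau>)) + (\<Sum>s\<in>S. real (card (D \<rho> (\<alpha> s))) + real (card (D \<rho> id)))) / n"
    by (simp add: divide_right_mono)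
  then show ?thesis
    unfolding perm_dist_def D_def by (simp add: add_divide_distrib sum_divide_distrib)
qed

text \<open>Apply almost multiplicativity to the product of the identity with itself; injectivity
  cancels one factor pointwise.\<close>

lemma asymptotic_hom_one:
  assumes "group G" "asymptotic_hom G n f"
  shows "(\<lambda>l. perm_dist (n l) (f l \<one>\<^bsub>G\<^esub>) id) \<longlonglongrightarrow> 0"
proof -
  interpret group G by fact
  have "perm_dist (n l) (f l \<one>\<^bsub>G\<^esub>) id
      = perm_dist (n l) (f l (\<one>\<^bsub>G\<^esub> \<otimes>\<^bsub>G\<^esub> \<one>\<^bsub>G\<^esub>)) (f l \<one>\<^bsub>G\<^esub> \<otimes>\<^bsub>sym_group (n l)\<^esub> f l \<one>\<^bsub>G\<^esub>)" for l
  proof -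
    have "f l \<one>\<^bsub>G\<^esub> \<in> carrier (sym_group (n l))"
      using assms(2) one_closed unfolding asymptotic_hom_def Pi_iff by blast
    then have "f l \<one>\<^bsub>G\<^esub> permutes {1..n l}"
      by (simp only: sym_group_carrier)
    then have "inj (f l \<one>\<^bsub>G\<^esub>)"
      by (rule permutes_inj)
    then have "f l \<one>\<^bsub>G\<^esub> x = f l \<one>\<^bsub>G\<^esub> (f l \<one>\<^bsub>G\<^esub> x) \<longleftrightarrow> f l \<one>\<^bsub>G\<^esub> x = x" for x
      by (metis injD)
    then show ?thesis
      unfolding perm_dist_def by (simp add: sym_group_mult)
  qed
  then show ?thesis
    using assms(2) unfolding asymptotic_hom_def by (simp only: one_closed)
qed

lemma asymptotic_hom_comp:
  assumes "\<pi> \<in> hom G H" "asymptotic_hom H n f"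
  shows "asymptotic_hom G n (\<lambda>l \<gamma>. f l (\<pi> \<gamma>))"
  unfolding asymptotic_hom_def
proof (intro conjI ballI)
  fix a b assume "a \<in> carrier G" "b \<in> carrier G"
  then show "(\<lambda>l. perm_dist (n l) (f l (\<pi> (a \<otimes>\<^bsub>G\<^esub> b)))
      (f l (\<pi> a) \<otimes>\<^bsub>sym_group (n l)\<^esub> f l (\<pi> b))) \<longlonglongrightarrow> 0"
    using assms(2) hom_in_carrier[OF assms(1)] unfolding asymptotic_hom_def
    by (simp only: hom_mult[OF assms(1)])
next
  show "\<forall>l. (\<lambda>\<gamma>. f l (\<pi> \<gamma>)) \<in> carrier G \<rightarrow> carrier (sym_group (n l))"
    using assms(2) hom_in_carrier[OF assms(1)] unfolding asymptotic_hom_def Pi_iff by blast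
qed (use assms(2) in \<open>simp_all add: asymptotic_hom_def\<close>)

text \<open>Both claims reduce to this descent. Generators of \<open>N\<close> lie in the identity
  coset, so \<open>h l s\<close> is close to \<open>f l N\<close>, which is close to
  \<open>id\<close>. Hence most points are fixed by \<open>N\<close>, and the factored action stays
  close to \<open>h l\<close>.\<close>

lemma correctable_Mod:
  fixes G (structure)
  assumes N: "N \<lhd> G" and fg: "finitely_generated (G\<lparr>carrier := N\<rparr>)"
    and f: "asymptotic_hom (G Mod N) n f"
    and cor: "correctable \<nu> G n (\<lambda>l \<gamma>. f l (N #> \<gamma>))"
  shows "correctable \<nu> (G Mod N) n f"
proof -
  interpret normal N G by fact
  obtain S where "finite S" "S \<subseteq> N" "generate (G\<lparr>carrier := N\<rparr>) S = N"
    using fg unfolding finitely_generated_def by auto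
  then have S: "finite S" "S \<subseteq> N" "generate G S = N"
    using generate_consistent[OF _ is_subgroup] by auto
  obtain \<epsilon> m h where \<epsilon>: "\<forall>l. 0 < \<epsilon> l" "\<epsilon> \<longlonglongrightarrow> 0"
    and h: "\<And>l. h l \<in> hom G (sym_group (m l))"
    and m: "\<forall>l. n l \<le> m l \<and> enat (m l) \<le> enat (n l) + \<nu> (\<epsilon> l) (n l)"
    and lim: "\<And>\<gamma>. \<gamma> \<in> carrier G \<Longrightarrow> (\<lambda>l. perm_dist (n l) (f l (N #> \<gamma>)) (h l \<gamma>)) \<longlonglongrightarrow> 0"
    using cor unfolding correctable_def by blast
  have "\<forall>l. \<exists>k. k \<in> hom (G Mod N) (sym_group (m l)) \<and>
      (\<forall>\<gamma>\<in>carrier G. \<forall>x. k (N #> \<gamma>) x = (if \<forall>a\<in>N. h l a x = x then h l \<gamma> x else x))"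
    by (rule allI, rule trivial_off_fixed_points_factor[OF N h]) blast
  from choice[OF this] obtain k where "\<forall>l. k l \<in> hom (G Mod N) (sym_group (m l)) \<and>
      (\<forall>\<gamma>\<in>carrier G. \<forall>x. k l (N #> \<gamma>) x = (if \<forall>a\<in>N. h l a x = x then h l \<gamma> x else x))" ..
  then have k_hom: "\<And>l. k l \<in> hom (G Mod N) (sym_group (m l))"
    and k: "\<And>l \<gamma> x. \<gamma> \<in> carrier G \<Longrightarrow>
      k l (N #> \<gamma>) x = (if \<forall>a\<in>N. h l a x = x then h l \<gamma> x else x)"
    by blast+
  have k_eq: "k l (N #> \<gamma>) x = h l \<gamma> x"
    if "\<gamma> \<in> carrier G" "\<And>s. s \<in> S \<Longrightarrow> h l s x = x" for l \<gamma> x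
  proof -
    \<comment> \<open>The stabilizer of \<open>x\<close> is a subgroup containing \<open>S\<close>,
      so it contains \<open>N\<close> and the first branch of \<open>k\<close> applies.\<close>
    have "generate G S \<subseteq> {\<gamma> \<in> carrier G. h l \<gamma> x = x}"
      using that(2) S(2) subset
      by (intro generate_subgroup_incl fixed_points_subgroup[OF is_group h]) auto
    then show ?thesis
      using k[OF that(1)] S(3) by auto
  qed
  have "(\<lambda>l. perm_dist (n l) (f l C) (k l C)) \<longlonglongrightarrow> 0" if C: "C \<in> carrier (G Mod N)" for C
  proof -
    obtain \<gamma> where \<gamma>: "\<gamma> \<in> carrier G" "C = N #> \<gamma>"
      using C by (auto simp: carrier_FactGroup)
    \<comment> \<open>The union bound with \<open>\<rho>\<close> taken to be \<open>f l N\<close>,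
      the value at the identity coset. The sum over the finite set \<open>S\<close> does not depend
      on \<open>l\<close> in length, so termwise limits suffice.\<close>
    let ?b = "\<lambda>l. perm_dist (n l) (f l (N #> \<gamma>)) (h l \<gamma>)
      + (\<Sum>s\<in>S. perm_dist (n l) (f l N) (h l s) + perm_dist (n l) (f l N) id)"
    have "?b \<longlonglongrightarrow> 0 + (\<Sum>s\<in>S. 0 + 0)"
    proof (intro tendsto_add tendsto_sum lim \<gamma>)
      fix s assume "s \<in> S"
      then have s: "s \<in> N" using S(2) by blast
      have "N #> s = N"
        using s coset_join2[OF _ is_subgroup] subset by blast
      then show "(\<lambda>l. perm_dist (n l) (f l N) (h l s)) \<longlonglongrightarrow> 0"
        using lim[of s] s by simp
      show "(\<lambda>l. perm_dist (n l) (f l N) id) \<longlonglongrightarrow> 0"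
        using asymptotic_hom_one[OF factorgroup_is_group f] by simp
    qed
    then have b: "?b \<longlonglongrightarrow> 0" by simp
    show ?thesis
    proof (rule tendsto_sandwich[OF always_eventually always_eventually tendsto_const b]; rule allI)
      fix l
      show "0 \<le> perm_dist (n l) (f l C) (k l C)"
        by (simp add: perm_dist_def)
      show "perm_dist (n l) (f l C) (k l C) \<le> ?b l"
        unfolding \<gamma>(2) using S(1) k_eq[OF \<gamma>(1)] by (rule perm_dist_le_trivial_off_fixed_points)
    qed
  qed
  then show ?thesis
    unfolding correctable_def using \<epsilon> m k_hom
    by (intro exI[of _ \<epsilon>] exI[of _ m] exI[of _ k] conjI) auto
qed

section \<open>Total variation of stabilizer statistics under pullback\<close>

lemma tv_dist_map_pmf:
  assumes inj: "inj_on F A" and p: "set_pmf p \<subseteq> A" and q: "set_pmf q \<subseteq> A"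
  shows "tv_dist (map_pmf F p) (map_pmf F q) = tv_dist p q"
proof -
  have pmf_F: "pmf (map_pmf F r) (F x) = pmf r x" if "set_pmf r \<subseteq> A" "x \<in> A" for r x
  proof (cases "x \<in> set_pmf r")
    case True
    then show ?thesis
      using that inj by (simp add: inj_on_subset pmf_map_inj)
  next
    \<comment> \<open>Injectivity on all of \<open>A\<close>, not only on the support of
      \<open>r\<close>, keeps \<open>F x\<close> outside the image of that support.\<close>
    case False
    then have "F x \<notin> F ` set_pmf r"
      using that inj by (auto simp: inj_on_def)
    then show ?thesis
      using False by (simp add: pmf_map_outside pmf_eq_0_set_pmf)
  qed
  have zero: "pmf r x = 0" if "set_pmf r \<subseteq> A" "x \<notin> A" for r x
    using that by (auto simp: pmf_eq_0_set_pmf)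
  have zero_F: "pmf (map_pmf F r) y = 0" if "set_pmf r \<subseteq> A" "y \<notin> F ` A" for r y
    using that by (intro pmf_map_outside) auto
  have "(\<Sum>\<^sub>\<infinity>y. \<bar>pmf (map_pmf F p) y - pmf (map_pmf F q) y\<bar>)
      = (\<Sum>\<^sub>\<infinity>y\<in>F ` A. \<bar>pmf (map_pmf F p) y - pmf (map_pmf F q) y\<bar>)"
    using p q by (intro infsum_cong_neutral) (auto simp: zero_F)
  also have "\<dots> = (\<Sum>\<^sub>\<infinity>x\<in>A. \<bar>pmf p x - pmf q x\<bar>)"
    using p q by (subst infsum_reindex[OF inj]) (auto simp: pmf_F intro!: infsum_cong)
  also have "\<dots> = (\<Sum>\<^sub>\<infinity>x. \<bar>pmf p x - pmf q x\<bar>)"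
    using p q by (intro infsum_cong_neutral) (auto simp: zero)
  finally show ?thesis
    by (simp add: tv_dist_def)
qed

text \<open>The elements of \<open>Q\<close> fixing a point after pullback form the preimage of
  those in \<open>\<pi>\<close>
  Q\<open>fixing it, and taking preimages is injective on subsets of\<close>\<pi>
  \<open>Q\<close>.\<close>

lemma tv_dist_stabilizer_pmf_comp:
  "tv_dist (stabilizer_pmf n (\<lambda>\<gamma>. f (\<pi> \<gamma>)) Q) (stabilizer_pmf n (\<lambda>\<gamma>. g (\<pi> \<gamma>)) Q)
    = tv_dist (stabilizer_pmf n f (\<pi> ` Q)) (stabilizer_pmf n g (\<pi> ` Q))"
proof -
  let ?F = "\<lambda>A. {\<gamma> \<in> Q. \<pi> \<gamma> \<in> A}"
  have F: "stabilizer_pmf n (\<lambda>\<gamma>. f (\<pi> \<gamma>)) Q = map_pmf ?F (stabilizer_pmf n f (\<pi> ` Q))" for f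
    by (auto simp: stabilizer_pmf_def map_pmf_comp intro!: map_pmf_cong)
  have "inj_on ?F (Pow (\<pi> ` Q))"
    by (rule inj_on_inverseI[of _ "\<lambda>B. \<pi> ` B"]) auto
  moreover have "set_pmf (stabilizer_pmf n f (\<pi> ` Q)) \<subseteq> Pow (\<pi> ` Q)" for f
    by (auto simp: stabilizer_pmf_def)
  ultimately show ?thesis
    unfolding F by (intro tv_dist_map_pmf)
qed

section \<open>Stability and rigidity pass to the quotient\<close>

lemma flexibly_stable_Mod:
  assumes N: "N \<lhd> G" and fg: "finitely_generated (G\<lparr>carrier := N\<rparr>)"
    and st: "flexibly_stable \<nu> G"
  shows "flexibly_stable \<nu> (G Mod N)"
  unfolding flexibly_stable_def
proof (intro allI impI)
  fix n f
  assume f: "asymptotic_hom (G Mod N) n f"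
  have "correctable \<nu> G n (\<lambda>l \<gamma>. f l (N #>\<^bsub>G\<^esub> \<gamma>))"
    using st asymptotic_hom_comp[OF normal.r_coset_hom_Mod[OF N] f]
    unfolding flexibly_stable_def by simp
  then show "correctable \<nu> (G Mod N) n f"
    by (rule correctable_Mod[OF N fg f])
qed

text \<open>The comparison homomorphisms \<open>g l\<close> are pulled back together with
  \<open>f l\<close>; statistics over a finite \<open>Q\<close> in \<open>G\<close> become
  statistics over its finite image in the quotient.\<close>

lemma flexibly_BS_rigid_Mod:
  assumes N: "N \<lhd> G" and fg: "finitely_generated (G\<lparr>carrier := N\<rparr>)"
    and rig: "flexibly_BS_rigid \<nu> G"
  shows "flexibly_BS_rigid \<nu> (G Mod N)"
  unfolding flexibly_BS_rigid_def
proof (intro allI impI, elim conjE exE)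
  fix n f g
  assume f: "asymptotic_hom (G Mod N) n f"
    and g: "\<forall>l. g l \<in> hom (G Mod N) (sym_group (n l))"
    and lim: "\<forall>Q. finite Q \<and> Q \<subseteq> carrier (G Mod N) \<longrightarrow>
      (\<lambda>l. tv_dist (stabilizer_pmf (n l) (f l) Q) (stabilizer_pmf (n l) (g l) Q)) \<longlonglongrightarrow> 0"
  let ?\<pi> = "r_coset G N"
  note \<pi> = normal.r_coset_hom_Mod[OF N]
  have "(\<lambda>\<gamma>. g l (?\<pi> \<gamma>)) \<in> hom G (sym_group (n l))" for l
    using hom_compose[OF \<pi>] g by (auto simp: comp_def)
  moreover have "(\<lambda>l. tv_dist (stabilizer_pmf (n l) (\<lambda>\<gamma>. f l (?\<pi> \<gamma>)) Q)
      (stabilizer_pmf (n l) (\<lambda>\<gamma>. g l (?\<pi> \<gamma>)) Q)) \<longlonglongrightarrow> 0"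
    if "finite Q" "Q \<subseteq> carrier G" for Q
    using that lim hom_in_carrier[OF \<pi>] by (subst tv_dist_stabilizer_pmf_comp) blast
  ultimately have "correctable \<nu> G n (\<lambda>l \<gamma>. f l (?\<pi> \<gamma>))"
    using asymptotic_hom_comp[OF \<pi> f]
    by (intro rig[unfolded flexibly_BS_rigid_def, rule_format]
        conjI exI[of _ "\<lambda>l \<gamma>. g l (?\<pi> \<gamma>)"]) auto
  then show "correctable \<nu> (G Mod N) n f"
    by (rule correctable_Mod[OF N fg f])
qed

theorem proposition1p24:
  fixes G :: "('a, 'b) monoid_scheme"
    and N :: "'a set"
    and \<nu> :: "real \<Rightarrow> nat \<Rightarrow> enat"
  assumes "group G"
    and "finitely_generated G"
    and "N \<lhd> G"
    and "finitely_generated (G\<lparr>carrier := N\<rparr>)"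
    and "\<And>k. 0 < k \<Longrightarrow> mono_on {0<..} (\<lambda>\<epsilon>. \<nu> \<epsilon> k)"
  shows "(stable G \<longrightarrow> stable (G Mod N)) \<and>
         (flexibly_stable \<nu> G \<longrightarrow> flexibly_stable \<nu> (G Mod N)) \<and>
         (BS_rigid G \<longrightarrow> BS_rigid (G Mod N)) \<and>
         (flexibly_BS_rigid \<nu> G \<longrightarrow> flexibly_BS_rigid \<nu> (G Mod N))"
  \<comment> \<open>Each lemma is used twice, for the given \<open>\<nu>\<close> and for the
    constant 0.\<close>
  using flexibly_stable_Mod[OF assms(3,4)] flexibly_BS_rigid_Mod[OF assms(3,4)]
  unfolding stable_def BS_rigid_def by blast

end
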